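(* Let $G$ be a graph and let $e\in E(G)$. If $S_e$ is the equivalence class of $e$ under $\mathcal{C}_G$, then the graph $G[S_e]$ is not properly quasi-transitively colourable.
   Context: A quasi-transitive $2$-edge-colouring of a graph $G$ is a map $c: E(G)\to\{R,B\}$ such that for all pairs of edges $xy, yz \in E(G)$ with $c(xy)\neq c(yz)$, we have $xz\in E(G)$; it is trivial if it is constant on $E(G)$, and a graph is properly quasi-transitively colourable if it admits a nontrivial one. $\mathcal{C}_G$ is the equivalence relation on $E(G)$ with $e\sim f$ iff $c(e)=c(f)$ for every quasi-transitive $2$-edge-colouring $c$ of $G$. For a set of edges $E$, $G[E]$ is the graph with edge set $E$ and vertex set the set of endpoints of edges in $E$. *)

theory Defs imports Main begin

record 'a graph =
  verts :: "'a set"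
  edges :: "'a set set"

definition simple_graph :: "'a graph \<Rightarrow> bool" where
  "simple_graph G \<longleftrightarrow> (\<forall>e \<in> edges G. e \<subseteq> verts G \<and> card e = 2)"

datatype colour = Red | Blue

text \<open>A colouring is a total function of which only the values on \<^term>\<open>edges G\<close> matter.
  The case \<open>x = z\<close> below is vacuous, since then both edges coincide.\<close>

definition quasi_transitive_colouring :: "'a graph \<Rightarrow> ('a set \<Rightarrow> colour) \<Rightarrow> bool" where
  "quasi_transitive_colouring G c \<longleftrightarrow>
     (\<forall>x y z. {x, y} \<in> edges G \<and> {y, z} \<in> edges G \<and> c {x, y} \<noteq> c {y, z}
        \<longrightarrow> {x, z} \<in> edges G)"

definition trivial_colouring :: "'a graph \<Rightarrow> ('a set \<Rightarrow> colour) \<Rightarrow> bool" where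
  "trivial_colouring G c \<longleftrightarrow> (\<exists>k. \<forall>e \<in> edges G. c e = k)"

definition properly_quasi_transitively_colourable :: "'a graph \<Rightarrow> bool" where
  "properly_quasi_transitively_colourable G \<longleftrightarrow>
     (\<exists>c. quasi_transitive_colouring G c \<and> \<not> trivial_colouring G c)"

definition colour_equiv :: "'a graph \<Rightarrow> ('a set \<times> 'a set) set" where
  "colour_equiv G = {(e, f). e \<in> edges G \<and> f \<in> edges G \<and>
     (\<forall>c. quasi_transitive_colouring G c \<longrightarrow> c e = c f)}"

text \<open>For \<open>S \<subseteq> E(G)\<close> this is \<open>G[S]\<close>; it depends on \<open>S\<close> only.\<close>

definition edge_induced_graph :: "'a set set \<Rightarrow> 'a graph" where
  "edge_induced_graph S = \<lparr>verts = \<Union>S, edges = S\<rparr>"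

lemma equiv_colour_equiv: "equiv (edges G) (colour_equiv G)"
  by (rule equivI) (auto simp: colour_equiv_def refl_on_def sym_def trans_def)

lemma simple_graph_edge_induced_graph:
  "simple_graph G \<Longrightarrow> S \<subseteq> edges G \<Longrightarrow> simple_graph (edge_induced_graph S)"
  by (auto simp: simple_graph_def edge_induced_graph_def)

end

theory Submission imports Defs begin

text \<open>Quasi-transitivity only says that adjacent edges \<open>xy\<close>, \<open>yz\<close> with \<open>xz\<close> not an edge
  receive the same colour. Such edges therefore lie in the same class, so a quasi-transitive
  colouring of \<open>G[S\<^sub>e]\<close> stays quasi-transitive on \<open>G\<close> after recolouring: red for the edges of
  \<open>S\<^sub>e\<close> coloured like \<open>e\<close>, blue for everything else. As all of \<open>S\<^sub>e\<close> is then red,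
  the given colouring is constant.\<close>

lemma colour_equiv_if_non_adjacent:
  assumes "{x, y} \<in> edges G" "{y, z} \<in> edges G" "{x, z} \<notin> edges G"
  shows "({x, y}, {y, z}) \<in> colour_equiv G"
proof -
  have "c {x, y} = c {y, z}" if "quasi_transitive_colouring G c" for c
    using that[unfolded quasi_transitive_colouring_def, rule_format, of x y z] assms by argo
  with assms(1,2) show ?thesis
    by (simp add: colour_equiv_def)
qed

text \<open>The edges of a violating triple are equivalent, so \<open>S\<close> contains both or
  neither; the class boundary thus causes no violation, and one inside \<open>S\<close> would
  already violate \<open>qt\<close>.\<close>

lemma quasi_transitive_colouring_extend_class:
  fixes G :: "'a graph" and e :: "'a set"
  defines "S \<equiv> colour_equiv G `` {e}"
  assumes qt: "quasi_transitive_colouring (edge_induced_graph S) c"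
  shows "quasi_transitive_colouring G (\<lambda>f. if f \<in> S \<and> c f = k then Red else Blue)"
    (is "quasi_transitive_colouring G ?d")
  unfolding quasi_transitive_colouring_def
proof (intro allI impI, elim conjE, rule ccontr)
  fix x y z
  assume xy: "{x, y} \<in> edges G" and yz: "{y, z} \<in> edges G"
    and neq: "?d {x, y} \<noteq> ?d {y, z}" and xz: "{x, z} \<notin> edges G"
  have "({x, y}, {y, z}) \<in> colour_equiv G"
    using xy yz xz by (rule colour_equiv_if_non_adjacent)
  then have iff: "{x, y} \<in> S \<longleftrightarrow> {y, z} \<in> S"
    unfolding S_def colour_equiv_def by auto
  \<comment> \<open>Outside \<open>S\<close> both edges would be \<open>Blue\<close>, against
    \<open>neq\<close>.\<close>
  with neq have "{x, y} \<in> S" "{y, z} \<in> S" "c {x, y} \<noteq> c {y, z}"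
    by (auto split: if_splits)
  with qt[unfolded quasi_transitive_colouring_def, rule_format, of x y z] have "{x, z} \<in> S"
    by (simp add: edge_induced_graph_def)
  with xz show False
    unfolding S_def colour_equiv_def by auto
qed

theorem theorem18:
  fixes G :: "'a graph" and e :: "'a set"
  assumes "simple_graph G"
    and "e \<in> edges G"
  shows "\<not> properly_quasi_transitively_colourable (edge_induced_graph (colour_equiv G `` {e}))"
proof -
  let ?S = "colour_equiv G `` {e}"
  have "trivial_colouring (edge_induced_graph ?S) c"
    if qt: "quasi_transitive_colouring (edge_induced_graph ?S) c" for c
  proof -
    let ?d = "\<lambda>f. if f \<in> ?S \<and> c f = c e then Red else Blue"
    have d: "quasi_transitive_colouring G ?d"
      using qt by (rule quasi_transitive_colouring_extend_class)
    have "e \<in> ?S"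
      using assms(2) by (simp add: colour_equiv_def)
    have "c f = c e" if "f \<in> ?S" for f
    proof -
      have "\<forall>c. quasi_transitive_colouring G c \<longrightarrow> c e = c f"
        using that by (simp add: colour_equiv_def)
      from this[rule_format, OF d] have "?d e = ?d f" .
      then show ?thesis
        \<comment> \<open>Since \<open>?d e\<close> is \<open>Red\<close>, so is
          \<open>?d f\<close>, and \<open>Red\<close> is only given to edges with the
          \<open>c\<close>-colour of \<open>e\<close>.\<close>
        using \<open>e \<in> ?S\<close> by (metis colour.distinct(1))
    qed
    then show ?thesis
      unfolding trivial_colouring_def edge_induced_graph_def by auto
  qed
  then show ?thesis
    unfolding properly_quasi_transitively_colourable_def by blast
qed

end
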